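(* For any $m,m'\in\mathbb N$ with $m'\ge m$, $\Lambda_{\overline{\mathcal P}_{\le m'},\overline{\mathcal P}_{\le m}}\le\frac{m'}{m}$. Moreover, for any $\delta\in(0,\frac12]$ there exist a bid history $\mathcal H$ and a valuation vector $\mathbf v$ such that $\Lambda_{\overline{\mathcal P}_{\le m'},\overline{\mathcal P}_{\le m}}(\mathcal H,\mathbf v)\ge\frac{m'}{m}-\delta$. Thus the richness ratio of $\overline{\mathcal P}_{\le m'}$ is $\alpha=m/m'$.
   Context: Uniform price auction with $K$ identical units, repeated over a finite bid history $\mathcal H=[\boldsymbol\beta_-^t]_{t\in[T]}$ of competing bids. A bidder has valuation $\mathbf v$: $v_1\ge\dots\ge v_M>0$, $w_j=\frac1j\sum_{\ell\le j}v_\ell$. An $m$-uniform strategy $\langle(b_1,q_1),\dots,(b_m,q_m)\rangle$ ($b_1>\dots>b_m>0$, positive integer $q_j$, $Q_j=\sum_{\ell\le j}q_\ell\le M$) is the bid vector with $q_1$ copies of $b_1$, then $q_2$ copies of $b_2$, etc. With competing bids $\boldsymbol\beta_-$, the $K$ highest bids win a unit each (ties in favor of the bidder), $x$ is the bidder's number of winning bids, $V(\mathbf b;\boldsymbol\beta_-)=\sum_{j\le x}v_j$. $\overline{\mathcal P}_{\le m}$ is the set of $k$-uniform strategies, $k\le m$, with $b_\ell=w_{Q_\ell}$ for all $\ell$ (the safe undominated strategies with at most $m$ bid-quantity pairs). $\Lambda_{\mathscr B_c,\mathscr B}(\mathcal H,\mathbf v)=\frac{\max_{\mathbf b\in\mathscr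 B_c}\sum_tV(\mathbf b;\boldsymbol\beta_-^t)}{\max_{\mathbf b'\in\mathscr B}\sum_tV(\mathbf b';\boldsymbol\beta_-^t)}$, and $\Lambda_{\mathscr B_c,\mathscr B}$ is the supremum over all valuation vectors and bid histories of arbitrary length. If $\Lambda_{\mathscr B_c,\overline{\mathcal P}_{\le m}}\le\lambda$ and for every small $\delta>0$ some $(\mathcal H,\mathbf v)$ attains $\ge\lambda-\delta$, the richness ratio of $\mathscr B_c$ is $\alpha=1/\lambda$. *)

theory Defs
  imports Complex_Main "HOL-Library.Extended_Real"
begin

text \<open>
  Vectors are lists, so the mathematical entry with index \<open>j\<close> (counted from 1) is \<open>v ! (j - 1)\<close>.
  The demand \<open>M\<close> of the bidder is \<open>length v\<close>. A bid history is the list of the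
  competing bid vectors of the rounds; a round may have any finite number of competing bids.
\<close>

definition valuation :: "real list \<Rightarrow> bool" where
  "valuation v \<longleftrightarrow> v \<noteq> [] \<and> sorted_wrt (\<ge>) v \<and> (\<forall>x\<in>set v. x > 0)"

definition bid_history :: "real list list \<Rightarrow> bool" where
  "bid_history H \<longleftrightarrow> H \<noteq> [] \<and> (\<forall>\<beta>\<in>set H. \<forall>x\<in>set \<beta>. x \<ge> 0)"

definition avg_val :: "real list \<Rightarrow> nat \<Rightarrow> real" where
  "avg_val v j = (\<Sum>l<j. v ! l) / real j"


subsection \<open>The auction\<close>

text \<open>
  The bid \<open>b ! i\<close> is among the \<open>K\<close> highest bids iff fewer than \<open>K\<close> bids are ranked ahead of it.
  A competing bid is ranked ahead only if it is strictly higher (ties in favor of the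
  bidder); equal bids of the bidder are ranked by position.
\<close>

definition winning_bids :: "nat \<Rightarrow> real list \<Rightarrow> real list \<Rightarrow> nat set" where
  "winning_bids K b \<beta> =
    {i. i < length b \<and>
        card {j. j < length b \<and> (b ! j > b ! i \<or> b ! j = b ! i \<and> j < i)}
        + card {j. j < length \<beta> \<and> \<beta> ! j > b ! i} < K}"

definition num_won :: "nat \<Rightarrow> real list \<Rightarrow> real list \<Rightarrow> nat" where
  "num_won K b \<beta> = card (winning_bids K b \<beta>)"

definition won_value :: "nat \<Rightarrow> real list \<Rightarrow> real list \<Rightarrow> real list \<Rightarrow> real" where
  "won_value K v b \<beta> = (\<Sum>j<num_won K b \<beta>. v ! j)"

definition total_value :: "nat \<Rightarrow> real list \<Rightarrow> real list list \<Rightarrow> real list \<Rightarrow> real" where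
  "total_value K v H b = (\<Sum>t<length H. won_value K v b (H ! t))"


subsection \<open>Uniform strategies\<close>

type_synonym bid_pairs = "(real \<times> nat) list"

definition cum_qty :: "bid_pairs \<Rightarrow> nat \<Rightarrow> nat" where
  "cum_qty s l = (\<Sum>i<l. snd (s ! i))"

definition uniform_strategy :: "nat \<Rightarrow> nat \<Rightarrow> bid_pairs \<Rightarrow> bool" where
  "uniform_strategy M k s \<longleftrightarrow>
    length s = k \<and> sorted_wrt (>) (map fst s) \<and>
    (\<forall>(b, q)\<in>set s. b > 0 \<and> q > 0) \<and> cum_qty s k \<le> M"

definition bid_vector :: "bid_pairs \<Rightarrow> real list" where
  "bid_vector s = concat (map (\<lambda>(b, q). replicate q b) s)"

definition safe_undominated :: "nat \<Rightarrow> real list \<Rightarrow> real list set" where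
  "safe_undominated m v =
    {bid_vector s | s k. 1 \<le> k \<and> k \<le> m \<and> uniform_strategy (length v) k s \<and>
       (\<forall>l\<in>{1..k}. fst (s ! (l - 1)) = avg_val v (cum_qty s l))}"


subsection \<open>Value ratio and richness ratio\<close>

text \<open>
  A strategy class may depend on the valuation vector, hence the type
  \<^typ>\<open>real list \<Rightarrow> real list set\<close>. The maxima exist although a class may be infinite:
  a bid vector of length at most \<open>M\<close> wins between 0 and \<open>M\<close> units in each round, so the total
  values form a finite set. The ratio is taken in the extended reals, where \<open>x / 0 = \<infinity>\<close>
  for \<open>x > 0\<close> and \<open>0 / 0 = 0\<close>, so that instances in which no unit can be won by
  either class do not affect the supremum.
\<close>

definition max_value ::
    "(real list \<Rightarrow> real list set) \<Rightarrow> nat \<Rightarrow> real list list \<Rightarrow> real list \<Rightarrow> real" where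
  "max_value B K H v = Max (total_value K v H ` B v)"

definition value_ratio ::
    "(real list \<Rightarrow> real list set) \<Rightarrow> (real list \<Rightarrow> real list set) \<Rightarrow>
     nat \<Rightarrow> real list list \<Rightarrow> real list \<Rightarrow> ereal" where
  "value_ratio Bc B K H v = ereal (max_value Bc K H v) / ereal (max_value B K H v)"

text \<open>The number \<open>K\<close> of units and the demand \<open>M\<close> range over all positive integers.\<close>

definition auction_instance :: "nat \<Rightarrow> real list list \<Rightarrow> real list \<Rightarrow> bool" where
  "auction_instance K H v \<longleftrightarrow> K \<ge> 1 \<and> bid_history H \<and> valuation v"

definition sup_value_ratio ::
    "(real list \<Rightarrow> real list set) \<Rightarrow> (real list \<Rightarrow> real list set) \<Rightarrow> ereal" where
  "sup_value_ratio Bc B = Sup {value_ratio Bc B K H v | K H v. auction_instance K H v}"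

definition has_richness_ratio ::
    "(real list \<Rightarrow> real list set) \<Rightarrow> nat \<Rightarrow> real \<Rightarrow> bool" where
  "has_richness_ratio Bc m \<alpha> \<longleftrightarrow>
    (\<exists>lam::real. lam > 0 \<and>
       sup_value_ratio Bc (safe_undominated m) \<le> ereal lam \<and>
       (\<exists>\<delta>\<^sub>0>0. \<forall>\<delta>\<in>{0<..\<delta>\<^sub>0}. \<exists>K H v. auction_instance K H v \<and>
          value_ratio Bc (safe_undominated m) K H v \<ge> ereal (lam - \<delta>)) \<and>
       \<alpha> = 1 / lam)"

end

(*
Upper bound: in a fixed round, a safe strategy wins exactly up to one of its bids, so its total
value splits over its at most m' bid-quantity pairs. Keeping only m pairs (with the cumulative
quantities, hence the bids, unchanged) preserves at least the value charged to the kept pairs, and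
the best m pairs carry at least a fraction m/m' of the total.

Tightness: with v = (2, 1, 1, ...) one has w_j = 1 + 1/j and v_1 + ... + v_j = j + 1. Let
Q_l = A^l - 1, and let A^(m'-l) rounds be such that at most Q_l units can be won, and only by bids
of at least w_(Q_l). The strategy with cumulative quantities Q_1, ..., Q_m' earns A^m' from each of
the m' types of rounds. A strategy with m pairs has a cumulative quantity in at most m of the windows
(Q_(l-1), Q_l], and from each round type with an empty window it earns at most A^(m'-1).
Let A tend to infinity.
*)
theory Submission
  imports Defs
begin

section \<open>Safe strategies and their wins\<close>

text \<open>With weakly decreasing bids, the own bids ranked ahead of index \<open>i\<close> are
  exactly those at smaller indices, and the number of higher competing bids can only grow with
  \<open>i\<close>. So the winners form a prefix, and all later win counts go through the second
  form.\<close>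

lemma winning_bids_sorted:
  assumes "sorted_wrt (\<ge>) b"
  shows "winning_bids K b \<beta> = {..<num_won K b \<beta>}"
    and "i < num_won K b \<beta> \<longleftrightarrow>
      i < length b \<and> i + length (filter (\<lambda>x. b ! i < x) \<beta>) < K"
proof -
  define W where "W = {i. i < length b \<and> i + length (filter (\<lambda>x. b ! i < x) \<beta>) < K}"
  have anti: "b ! j \<le> b ! i" if "i \<le> j" "j < length b" for i j
    using assms that by (cases "i = j") (auto simp: sorted_wrt_iff_nth_less)
  have "{j. j < length b \<and> (b ! j > b ! i \<or> b ! j = b ! i \<and> j < i)} = {..<i}"
    if "i < length b" for i
  proof -
    have "b ! j > b ! i \<or> b ! j = b ! i \<and> j < i \<longleftrightarrow> j < i" if "j < length b" for j
      using anti[of i j] anti[of j i] that \<open>i < length b\<close> by (cases "j < i") auto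
    then show ?thesis using that less_trans[of _ i "length b"] by blast
  qed
  then have W: "winning_bids K b \<beta> = W"
    unfolding winning_bids_def W_def by (auto simp: length_filter_conv_card)
  have down: "i \<in> W" if "j \<in> W" "i \<le> j" for i j
  proof -
    have "length (filter (\<lambda>x. b ! i < x) \<beta>) \<le> length (filter (\<lambda>x. b ! j < x) \<beta>)"
      using anti[of i j] that unfolding length_filter_conv_card W_def
      by (intro card_mono) auto
    then show ?thesis using that unfolding W_def by auto
  qed
  have "finite W" unfolding W_def by simp
  \<comment> \<open>A finite downward closed set of naturals is an initial segment, and its
    cardinality is then its length.\<close>
  have "W = {..<card W}"
  proof (cases "W = {}")
    case False
    have "W = {..Max W}" using down Max_in[OF \<open>finite W\<close> False] Max_ge[OF \<open>finite W\<close>] by auto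
    then show ?thesis by (metis card_atMost lessThan_Suc_atMost)
  qed simp
  then show *: "winning_bids K b \<beta> = {..<num_won K b \<beta>}"
    unfolding num_won_def W .
  show "i < num_won K b \<beta> \<longleftrightarrow>
      i < length b \<and> i + length (filter (\<lambda>x. b ! i < x) \<beta>) < K"
    using * W unfolding W_def by (metis (mono_tags, lifting) lessThan_iff mem_Collect_eq)
qed

section \<open>Bid vectors in terms of cumulative quantities\<close>

lemma cum_qty_Suc: "cum_qty s (Suc l) = cum_qty s l + snd (s ! l)"
  by (simp add: cum_qty_def)

lemma cum_qty_mono: "i \<le> j \<Longrightarrow> cum_qty s i \<le> cum_qty s j"
  unfolding cum_qty_def by (rule sum_mono2) auto

lemma cum_qty_less:
  assumes "\<forall>(b, q)\<in>set s. b > 0 \<and> q > 0" and "i < j" and "j \<le> length s"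
  shows "cum_qty s i < cum_qty s j"
proof -
  have "snd (s ! i) > 0" using bspec[OF assms(1) nth_mem[of i]] assms(2,3) by (simp add: case_prod_beta)
  then have "cum_qty s i < cum_qty s (Suc i)" by (simp add: cum_qty_Suc)
  also have "\<dots> \<le> cum_qty s j" using assms by (intro cum_qty_mono) simp
  finally show ?thesis .
qed

lemma cum_qty_snoc: "l \<le> length s \<Longrightarrow> cum_qty (s @ [p]) l = cum_qty s l"
  unfolding cum_qty_def by (intro sum.cong) (auto simp: nth_append)

lemma length_bid_vector: "length (bid_vector s) = cum_qty s (length s)"
proof (induction s rule: rev_induct)
  case (snoc p s)
  then show ?case
    by (cases p) (auto simp: bid_vector_def cum_qty_Suc cum_qty_snoc)
qed (simp add: bid_vector_def cum_qty_def)

lemma nth_bid_vector: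
  assumes "i < length s" and "cum_qty s i \<le> j" and "j < cum_qty s (Suc i)"
  shows "bid_vector s ! j = fst (s ! i)"
  using assms
proof (induction s rule: rev_induct)
  case (snoc p s)
  have *: "bid_vector (s @ [p]) = bid_vector s @ replicate (snd p) (fst p)"
    by (cases p) (simp add: bid_vector_def)
  show ?case
  proof (cases "i < length s")
    case True
    then have "j < cum_qty s (Suc i)" "cum_qty s i \<le> j"
      using snoc.prems by (simp_all add: cum_qty_snoc)
    moreover have "j < length (bid_vector s)"
      using calculation cum_qty_mono[of "Suc i" "length s" s] True
      by (simp add: length_bid_vector)
    ultimately show ?thesis using snoc.IH True by (simp add: * nth_append)
  next
    case False
    then have "i = length s" using snoc.prems by simp
    then show ?thesis using snoc.prems
      by (simp add: * nth_append length_bid_vector cum_qty_snoc cum_qty_Suc)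
  qed
qed simp

lemma cum_qty_locate:
  assumes "j < cum_qty s k"
  obtains i where "i < k" "cum_qty s i \<le> j" "j < cum_qty s (Suc i)"
proof -
  have "cum_qty s 0 \<le> j" by (simp add: cum_qty_def)
  then have "\<exists>i<k. cum_qty s i \<le> j \<and> j < cum_qty s (Suc i)"
    using assms
  proof (induction k)
    case (Suc k)
    then show ?case by (cases "j < cum_qty s k") (auto simp: not_less intro: less_SucI)
  qed simp
  then show ?thesis using that by blast
qed

text \<open>
  A safe strategy is determined by its set of cumulative quantities
  \<open>R = {Q\<^sub>1, \<dots>, Q\<^sub>k}\<close>: the bid with 0-based index \<open>j\<close> is \<open>w\<^sub>r\<close> for the least \<open>r \<in> R\<close> above \<open>j\<close>.
\<close>

definition next_qty :: "nat set \<Rightarrow> nat \<Rightarrow> nat" where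
  "next_qty R j = (LEAST r. r \<in> R \<and> j < r)"

definition safe_bids :: "real list \<Rightarrow> nat set \<Rightarrow> real list" where
  "safe_bids v R = map (\<lambda>j. avg_val v (next_qty R j)) [0..<Max R]"

text \<open>The condition on averages is the strict decrease of the bids. It is a real restriction:
  along an initial stretch where \<open>v\<close> is constant the averages coincide, so at most one
  quantity from that stretch may occur.\<close>

definition safe_qtys :: "nat \<Rightarrow> real list \<Rightarrow> nat set set" where
  "safe_qtys m v = {R. R \<noteq> {} \<and> R \<subseteq> {1..length v} \<and> card R \<le> m \<and>
     (\<forall>r\<in>R. \<forall>r'\<in>R. r < r' \<longrightarrow> avg_val v r' < avg_val v r)}"

lemma next_qty:
  assumes "finite R" and "R \<noteq> {}" and "j < Max R"
  shows "next_qty R j \<in> R" and "j < next_qty R j"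
    and "r \<in> R \<Longrightarrow> j < r \<Longrightarrow> next_qty R j \<le> r"
proof -
  have "\<exists>r. r \<in> R \<and> j < r" using assms Max_in by blast
  from LeastI_ex[OF this] show "next_qty R j \<in> R" "j < next_qty R j"
    unfolding next_qty_def by auto
qed (simp add: next_qty_def Least_le)

lemma next_qty_eqI:
  assumes "r \<in> R" and "j < r" and "\<And>r'. r' \<in> R \<Longrightarrow> j < r' \<Longrightarrow> r \<le> r'"
  shows "next_qty R j = r"
  unfolding next_qty_def using assms by (intro Least_equality) auto

text \<open>The pair covering position \<open>j\<close> ends at the least cumulative quantity above
  \<open>j\<close>, and safety fixes its bid as the average up to that quantity.\<close>

lemma bid_vector_eq_safe_bids:
  assumes "uniform_strategy M k s" and "1 \<le> k"
    and "\<forall>l\<in>{1..k}. fst (s ! (l - 1)) = avg_val v (cum_qty s l)"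
  shows "bid_vector s = safe_bids v (cum_qty s ` {1..k})"
proof -
  have len: "length s = k" using assms(1) by (simp add: uniform_strategy_def)
  let ?R = "cum_qty s ` {1..k}"
  have Max: "Max ?R = cum_qty s k"
    using assms(2) by (intro Max_eqI) (auto intro: cum_qty_mono)
  show ?thesis
  proof (rule nth_equalityI)
    show "length (bid_vector s) = length (safe_bids v ?R)"
      by (simp add: length_bid_vector safe_bids_def Max len del: One_nat_def)
  next
    fix j assume "j < length (bid_vector s)"
    then have j: "j < cum_qty s k" by (simp add: length_bid_vector len)
    then obtain i where i: "i < k" "cum_qty s i \<le> j" "j < cum_qty s (Suc i)"
      by (rule cum_qty_locate)
    have "next_qty ?R j = cum_qty s (Suc i)"
    proof (rule next_qty_eqI)
      fix r assume "r \<in> ?R" "j < r"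
      then obtain l where l: "r = cum_qty s l" by blast
      with \<open>j < r\<close> i(2) have "i < l" using cum_qty_mono[of l i s] by (meson leD le_less_trans not_le)
      then show "cum_qty s (Suc i) \<le> r" unfolding l by (intro cum_qty_mono) simp
    qed (use i in auto)
    then show "bid_vector s ! j = safe_bids v ?R ! j"
      using nth_bid_vector[of i s j] i j bspec[OF assms(3), of "Suc i"]
      by (simp add: safe_bids_def Max len del: One_nat_def)
  qed
qed

lemma avg_val_pos:
  assumes "valuation v" and "0 < r" and "r \<le> length v"
  shows "0 < avg_val v r"
proof -
  have "0 < (\<Sum>l<r. v ! l)"
    using assms by (intro sum_pos) (auto simp: valuation_def)
  then show ?thesis using assms(2) by (simp add: avg_val_def)
qed

lemma safe_undominated_eq:
  assumes "valuation v"
  shows "safe_undominated m v = safe_bids v ` safe_qtys m v"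
proof (intro equalityI subsetI)
  fix b assume "b \<in> safe_undominated m v"
  then obtain s k where s: "b = bid_vector s" "1 \<le> k" "k \<le> m" "uniform_strategy (length v) k s"
      "\<forall>l\<in>{1..k}. fst (s ! (l - 1)) = avg_val v (cum_qty s l)"
    unfolding safe_undominated_def by blast
  from s(4) have len: "length s = k" and sorted: "sorted_wrt (>) (map fst s)"
    and pos: "\<forall>(b, q)\<in>set s. b > 0 \<and> q > 0" and M: "cum_qty s k \<le> length v"
    by (auto simp: uniform_strategy_def)
  let ?R = "cum_qty s ` {1..k}"
  have "?R \<in> safe_qtys m v"
    unfolding safe_qtys_def
  proof (intro CollectI conjI ballI impI)
    show "?R \<noteq> {}" using s(2) by simp
    show "?R \<subseteq> {1..length v}"
    proof
      fix r assume "r \<in> ?R"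
      then obtain l where l: "l \<in> {1..k}" "r = cum_qty s l" by blast
      then have "0 < r" using cum_qty_less[OF pos, of 0 l] len by simp
      moreover have "r \<le> length v" using l M cum_qty_mono[of l k s] by simp
      ultimately show "r \<in> {1..length v}" by simp
    qed
    show "card ?R \<le> m" using card_image_le[of "{1..k}" "cum_qty s"] s(3) by simp
  next
    fix r r' assume "r \<in> ?R" "r' \<in> ?R" "r < r'"
    then obtain l l' where l: "l \<in> {1..k}" "l' \<in> {1..k}" "r = cum_qty s l" "r' = cum_qty s l'"
      by blast
    then have "l < l'" using \<open>r < r'\<close> cum_qty_mono[of l' l s] by (meson leD not_le)
    then have "fst (s ! (l' - 1)) < fst (s ! (l - 1))"
      using sorted_wrt_nth_less[OF sorted, of "l - 1" "l' - 1"] l len by auto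
    then show "avg_val v r' < avg_val v r" using s(5) l by simp
  qed
  then show "b \<in> safe_bids v ` safe_qtys m v"
    using bid_vector_eq_safe_bids[OF s(4,2,5)] s(1) by blast
next
  fix b assume "b \<in> safe_bids v ` safe_qtys m v"
  then obtain R where R: "R \<noteq> {}" "R \<subseteq> {1..length v}" "card R \<le> m"
    "\<And>r r'. r \<in> R \<Longrightarrow> r' \<in> R \<Longrightarrow> r < r' \<Longrightarrow> avg_val v r' < avg_val v r"
    and b: "b = safe_bids v R"
    unfolding safe_qtys_def by blast
  have "finite R" using R(2) finite_subset by blast
  \<comment> \<open>The leading 0 serves as \<open>Q_0\<close>, so every quantity, including the
    first, is a difference of consecutive entries.\<close>
  define rs where "rs = 0 # sorted_list_of_set R"
  define k where "k = card R"
  define s where "s = map (\<lambda>i. (avg_val v (rs ! Suc i), rs ! Suc i - rs ! i)) [0..<k]"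
  have "k \<ge> 1" using R(1) \<open>finite R\<close> by (simp add: k_def Suc_le_eq card_gt_0_iff)
  have len: "length rs = Suc k" by (simp add: rs_def k_def)
  have Rrs: "R = (\<lambda>l. rs ! l) ` {1..k}"
  proof -
    have "R = set (sorted_list_of_set R)" using \<open>finite R\<close> by simp
    also have "\<dots> = (\<lambda>i. rs ! Suc i) ` {..<k}"
      unfolding rs_def k_def set_conv_nth by auto
    also have "\<dots> = (\<lambda>l. rs ! l) ` {1..k}"
      using image_image[of "(!) rs" Suc "{..<k}"] by (simp add: image_Suc_lessThan)
    finally show ?thesis .
  qed
  have sorted: "sorted_wrt (<) rs"
    using R(2) \<open>finite R\<close> by (auto simp: rs_def strict_sorted_list_of_set)
  have less: "rs ! i < rs ! j" if "i < j" "j \<le> k" for i j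
    using sorted_wrt_nth_less[OF sorted] that len by simp
  have cum: "cum_qty s l = rs ! l" if "l \<le> k" for l
    using that
  proof (induction l)
    case 0
    then show ?case by (simp add: cum_qty_def rs_def)
  next
    case (Suc l)
    then show ?case using less[of l "Suc l"] by (simp add: cum_qty_Suc s_def)
  qed
  have fst_s: "\<forall>l\<in>{1..k}. fst (s ! (l - 1)) = avg_val v (cum_qty s l)"
  proof
    fix l assume l: "l \<in> {1..k}"
    then have "fst (s ! (l - 1)) = avg_val v (rs ! l)" by (auto simp: s_def)
    then show "fst (s ! (l - 1)) = avg_val v (cum_qty s l)" using l cum by simp
  qed
  have R_iff: "rs ! l \<in> R" if "l \<in> {1..k}" for l using that by (subst Rrs) simp
  have "uniform_strategy (length v) k s"
    unfolding uniform_strategy_def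
  proof (intro conjI)
    show "length s = k" by (simp add: s_def)
    show "sorted_wrt (>) (map fst s)"
      unfolding sorted_wrt_iff_nth_less
      using R(4) less R_iff by (auto simp: s_def)
    show "\<forall>(b, q)\<in>set s. 0 < b \<and> 0 < q"
    proof -
      have "0 < avg_val v (rs ! Suc i) \<and> 0 < rs ! Suc i - rs ! i" if "i < k" for i
        using R_iff[of "Suc i"] that R(2) less[of i "Suc i"]
        by (auto intro!: avg_val_pos[OF assms])
      then show ?thesis by (auto simp: s_def)
    qed
    show "cum_qty s k \<le> length v" using R_iff[of k] R(2) \<open>k \<ge> 1\<close> by (auto simp: cum)
  qed
  moreover have "cum_qty s ` {1..k} = R"
    unfolding Rrs by (intro image_cong) (auto simp: cum)
  ultimately have "b = bid_vector s"
    using bid_vector_eq_safe_bids[OF _ \<open>k \<ge> 1\<close> fst_s] b by simp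
  then show "b \<in> safe_undominated m v"
    unfolding safe_undominated_def
    using \<open>k \<ge> 1\<close> R(3) \<open>uniform_strategy (length v) k s\<close> fst_s by (auto simp: k_def)
qed

lemma finite_safe_qtys: "finite (safe_qtys m v)"
  by (rule finite_subset[of _ "Pow {1..length v}"]) (auto simp: safe_qtys_def)

lemma safe_qtysD:
  assumes "R \<in> safe_qtys m v"
  shows "finite R" and "R \<noteq> {}" and "card R \<le> m" and "Max R \<le> length v"
    and "r \<in> R \<Longrightarrow> 1 \<le> r" and "r \<in> R \<Longrightarrow> r \<le> length v"
proof -
  have R: "R \<subseteq> {1..length v}" and ne: "R \<noteq> {}" and "card R \<le> m"
    using assms by (auto simp: safe_qtys_def)
  from R have "finite R" by (rule finite_subset) simp
  with R ne Max_in[of R] show "finite R" "R \<noteq> {}" "card R \<le> m" "Max R \<le> length v"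
    "r \<in> R \<Longrightarrow> 1 \<le> r" "r \<in> R \<Longrightarrow> r \<le> length v"
    using \<open>card R \<le> m\<close> by auto
qed

text \<open>Dropping pairs is harmless because each bid depends only on its own cumulative quantity,
  so the order of the remaining bids is inherited.\<close>

lemma safe_qtys_subset:
  "R \<in> safe_qtys m v \<Longrightarrow> T \<subseteq> R \<Longrightarrow> T \<noteq> {} \<Longrightarrow> card T \<le> n \<Longrightarrow> T \<in> safe_qtys n v"
  unfolding safe_qtys_def by blast

lemma sorted_safe_bids:
  assumes "R \<in> safe_qtys m v"
  shows "sorted_wrt (\<ge>) (safe_bids v R)"
proof -
  have "avg_val v (next_qty R j) \<le> avg_val v (next_qty R i)" if "i < j" "j < Max R" for i j
  proof -
    note R = safe_qtysD(1,2)[OF assms]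
    have mem: "next_qty R i \<in> R" "next_qty R j \<in> R" "next_qty R i \<le> next_qty R j"
      using next_qty[OF R, of i] next_qty[OF R, of j] that by auto
    then show ?thesis
      using assms by (cases "next_qty R i = next_qty R j") (auto simp: safe_qtys_def less_imp_le)
  qed
  then show ?thesis by (simp add: sorted_wrt_iff_nth_less safe_bids_def)
qed

section \<open>Units won by safe strategies\<close>

lemma less_num_won_safe_bids:
  assumes "R \<in> safe_qtys m v"
  shows "i < num_won K (safe_bids v R) \<beta> \<longleftrightarrow>
    i < Max R \<and> i + length (filter (\<lambda>x. avg_val v (next_qty R i) < x) \<beta>) < K"
  unfolding winning_bids_sorted(2)[OF sorted_safe_bids[OF assms]]
  by (auto simp: safe_bids_def)

lemma num_won_safe_bids_le:
  assumes "R \<in> safe_qtys m v"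
  shows "num_won K (safe_bids v R) \<beta> \<le> length v"
  using less_num_won_safe_bids[OF assms, of "length v" K \<beta>] safe_qtysD(4)[OF assms]
  by (meson leD not_le)

text \<open>If the pair covering position \<open>i\<close> is kept, then \<open>i\<close> has the
  same bid in the substrategy and still exactly \<open>i\<close> own bids ahead of it, so its win
  survives.\<close>

lemma less_num_won_subset:
  assumes R: "R \<in> safe_qtys m v" and T: "T \<in> safe_qtys n v" "T \<subseteq> R"
    and i: "i < num_won K (safe_bids v R) \<beta>" "next_qty R i \<in> T"
  shows "i < num_won K (safe_bids v T) \<beta>"
proof -
  have *: "i < Max R" "i + length (filter (\<lambda>x. avg_val v (next_qty R i) < x) \<beta>) < K"
    using i(1) unfolding less_num_won_safe_bids[OF R] by auto
  note nR = next_qty[OF safe_qtysD(1,2)[OF R] *(1)]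
  have "next_qty T i = next_qty R i"
    using nR T(2) i(2) by (intro next_qty_eqI) auto
  moreover have "i < Max T"
    using nR(2) Max_ge[OF safe_qtysD(1)[OF T(1)] i(2)] by simp
  ultimately show ?thesis unfolding less_num_won_safe_bids[OF T(1)] using * by simp
qed

lemma sum_valuation_mono:
  assumes "valuation v" and "x \<le> y" and "y \<le> length v"
  shows "(\<Sum>j<x. v ! j) \<le> (\<Sum>j<y. v ! j)"
  using assms by (intro sum_mono2) (auto simp: valuation_def less_imp_le)

lemma won_value_nonneg:
  assumes "valuation v" and "R \<in> safe_qtys m v"
  shows "0 \<le> won_value K v (safe_bids v R) \<beta>"
  using sum_valuation_mono[OF assms(1), of 0] num_won_safe_bids_le[OF assms(2)]
  by (simp add: won_value_def)

lemma total_value_nonneg: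
  assumes "valuation v" and "R \<in> safe_qtys m v"
  shows "0 \<le> total_value K v H (safe_bids v R)"
  unfolding total_value_def by (intro sum_nonneg won_value_nonneg[OF assms])

section \<open>The upper bound\<close>

text \<open>Deleting an element of least weight does not lower the average of the rest. The
  induction removes such elements from \<open>R\<close> one at a time until \<open>n\<close> are
  left.\<close>

lemma subset_sum_ge_average:
  fixes U :: "'a \<Rightarrow> real"
  assumes "finite R" and "n \<le> card R"
  shows "\<exists>T\<subseteq>R. card T = n \<and> real n * sum U R \<le> real (card R) * sum U T"
  using assms(2)
proof (induction n rule: inc_induct)
  case (step n)
  then obtain T where T: "T \<subseteq> R" "card T = Suc n"
    and le: "real (Suc n) * sum U R \<le> real (card R) * sum U T" by blast
  have "finite T" using T(1) assms(1) finite_subset by blast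
  moreover have "T \<noteq> {}" using T(2) by auto
  ultimately have "Min (U ` T) \<in> U ` T" by simp
  then obtain u where u: "u \<in> T" "U u = Min (U ` T)" by auto
  have "real (Suc n) * U u \<le> sum U T"
    using sum_bounded_below[of T "U u" U] u \<open>finite T\<close> T(2) by simp
  then have "real n * sum U T \<le> real (Suc n) * sum U (T - {u})"
    using u \<open>finite T\<close> by (simp add: sum_diff1 algebra_simps)
  then have "real (card R) * (real n * sum U T) \<le> real (card R) * (real (Suc n) * sum U (T - {u}))"
    by (rule mult_left_mono) simp
  moreover have "real n * (real (Suc n) * sum U R) \<le> real n * (real (card R) * sum U T)"
    using le by (rule mult_left_mono) simp
  ultimately have "real (Suc n) * (real n * sum U R)
      \<le> real (Suc n) * (real (card R) * sum U (T - {u}))"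
    by (simp only: mult_ac)
  then have "real n * sum U R \<le> real (card R) * sum U (T - {u})"
    by (rule mult_left_le_imp_le) simp
  then show ?case using T u \<open>finite T\<close> by (intro exI[of _ "T - {u}"]) auto
qed (use assms in auto)

text \<open>
  Each round with a win is charged to the pair holding the last winning bid. A substrategy that
  keeps this pair has the same bid at that position, hence wins at least as many units; so it
  suffices to keep the \<open>m\<close> pairs with the largest charges.
\<close>

lemma total_value_subset:
  assumes v: "valuation v" and R: "R \<in> safe_qtys m' v" and m: "1 \<le> m" "m \<le> m'"
  shows "\<exists>T\<in>safe_qtys m v. real m * total_value K v H (safe_bids v R)
    \<le> real m' * total_value K v H (safe_bids v T)"
proof (cases "card R \<le> m")
  case True
  then have "R \<in> safe_qtys m v" using safe_qtys_subset[OF R] safe_qtysD(2)[OF R] by blast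
  then show ?thesis
    using m total_value_nonneg[OF v R] by (intro bexI[of _ R] mult_right_mono) auto
next
  case False
  note finR = safe_qtysD(1)[OF R]
  define x where "x t = num_won K (safe_bids v R) (H ! t)" for t
  define g where "g t = next_qty R (x t - 1)" for t
  \<comment> \<open>Rounds without a win carry no value, and for them the truncated
    \<open>x t - 1\<close> would not point at a winning bid; only the rounds in \<open>A\<close> are
    charged.\<close>
  define A where "A = {t. t < length H \<and> 0 < x t}"
  define val where "val t = won_value K v (safe_bids v R) (H ! t)" for t
  define U where "U r = sum val {t \<in> A. g t = r}" for r
  have "finite A" by (simp add: A_def)
  have gR: "g t \<in> R" if "t \<in> A" for t
    using that next_qty(1)[OF safe_qtysD(1,2)[OF R], of "x t - 1"]
      less_num_won_safe_bids[OF R, of "x t - 1" K "H ! t"]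
    unfolding A_def g_def x_def by simp
  have "total_value K v H (safe_bids v R) = sum val A"
    unfolding total_value_def val_def[symmetric]
    by (rule sum.mono_neutral_right) (auto simp: A_def val_def won_value_def x_def)
  also have "\<dots> = sum U R"
    unfolding U_def using \<open>finite A\<close> finR gR by (intro sum.group[symmetric]) auto
  finally have total_R: "total_value K v H (safe_bids v R) = sum U R" .
  obtain T where T: "T \<subseteq> R" "card T = m" "real m * sum U R \<le> real (card R) * sum U T"
    using subset_sum_ge_average[OF finR, of m U] False by auto
  have "T \<noteq> {}" using T(2) m by auto
  then have T_safe: "T \<in> safe_qtys m v" using safe_qtys_subset[OF R T(1)] T(2) by simp
  \<comment> \<open>Grouping needs an index set mapped into \<open>T\<close> by \<open>g\<close>,
    hence the restriction to the rounds charged to kept pairs.\<close>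
  have "sum U T = (\<Sum>r\<in>T. sum val {t \<in> {t \<in> A. g t \<in> T}. g t = r})"
    unfolding U_def by (intro sum.cong arg_cong[of _ _ "sum val"]) auto
  also have "\<dots> = sum val {t \<in> A. g t \<in> T}"
    using \<open>finite A\<close> finite_subset[OF T(1) finR] by (intro sum.group) auto
  also have "\<dots> \<le> (\<Sum>t\<in>{t \<in> A. g t \<in> T}. won_value K v (safe_bids v T) (H ! t))"
  proof (rule sum_mono)
    fix t assume "t \<in> {t \<in> A. g t \<in> T}"
    then have "x t - 1 < num_won K (safe_bids v T) (H ! t)"
      by (intro less_num_won_subset[OF R T_safe T(1)]) (auto simp: A_def g_def x_def)
    then show "val t \<le> won_value K v (safe_bids v T) (H ! t)"
      unfolding val_def won_value_def x_def
      by (intro sum_valuation_mono[OF v] num_won_safe_bids_le[OF T_safe]) simp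
  qed
  also have "\<dots> \<le> total_value K v H (safe_bids v T)"
    unfolding total_value_def
    by (intro sum_mono2) (auto simp: A_def won_value_nonneg[OF v T_safe])
  finally have "sum U T \<le> total_value K v H (safe_bids v T)" .
  then have "real (card R) * sum U T \<le> real m' * total_value K v H (safe_bids v T)"
    using safe_qtysD(3)[OF R] total_value_nonneg[OF v T_safe, of K H]
    by (meson mult_left_mono mult_right_mono of_nat_0_le_iff of_nat_mono order_trans)
  then show ?thesis using T(3) T_safe total_R by (intro bexI[of _ T]) auto
qed

section \<open>Maximal values of the classes and their ratio\<close>

lemma max_value_safe_undominated:
  assumes "valuation v"
  shows "max_value (safe_undominated m) K H v
    = Max ((\<lambda>R. total_value K v H (safe_bids v R)) ` safe_qtys m v)"
  by (simp add: max_value_def safe_undominated_eq[OF assms] image_image)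

lemma safe_qtys_nonempty:
  assumes "valuation v" and "1 \<le> m"
  shows "safe_qtys m v \<noteq> {}"
proof -
  \<comment> \<open>A single pair bidding the first value for one unit; no two bids have to be
    compared.\<close>
  have "{1} \<in> safe_qtys m v"
    using assms by (cases v) (auto simp: safe_qtys_def valuation_def)
  then show ?thesis by blast
qed

lemma max_value_attained:
  assumes "valuation v" and "1 \<le> m"
  obtains R where "R \<in> safe_qtys m v"
    and "max_value (safe_undominated m) K H v = total_value K v H (safe_bids v R)"
  using Max_in[OF finite_imageI[OF finite_safe_qtys], of "\<lambda>R. total_value K v H (safe_bids v R)" m v]
    safe_qtys_nonempty[OF assms] that
  unfolding max_value_safe_undominated[OF assms(1)] by auto

lemma total_value_le_max_value:
  assumes "valuation v" and "R \<in> safe_qtys m v"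
  shows "total_value K v H (safe_bids v R) \<le> max_value (safe_undominated m) K H v"
  unfolding max_value_safe_undominated[OF assms(1)]
  using assms(2) by (intro Max_ge finite_imageI finite_safe_qtys) auto

lemma max_value_nonneg:
  assumes "valuation v" and "1 \<le> m"
  shows "0 \<le> max_value (safe_undominated m) K H v"
  using max_value_attained[OF assms, of K H] total_value_nonneg[OF assms(1)] by metis

text \<open>Stated without division because the maximum over the smaller class may be 0.\<close>

lemma max_value_ratio:
  assumes "valuation v" and "1 \<le> m" and "m \<le> m'"
  shows "real m * max_value (safe_undominated m') K H v
    \<le> real m' * max_value (safe_undominated m) K H v"
proof -
  obtain R where R: "R \<in> safe_qtys m' v"
    "max_value (safe_undominated m') K H v = total_value K v H (safe_bids v R)"
    using max_value_attained[OF assms(1), of m' K H] assms(2,3) by auto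
  obtain T where T: "T \<in> safe_qtys m v" "real m * total_value K v H (safe_bids v R)
    \<le> real m' * total_value K v H (safe_bids v T)"
    using total_value_subset[OF assms(1) R(1) assms(2,3)] by blast
  note T(2)
  also have "real m' * total_value K v H (safe_bids v T)
      \<le> real m' * max_value (safe_undominated m) K H v"
    by (intro mult_left_mono total_value_le_max_value[OF assms(1) T(1)]) simp
  finally show ?thesis by (simp add: R(2))
qed

lemma sup_value_ratio_le:
  assumes "1 \<le> m" and "m \<le> m'"
  shows "sup_value_ratio (safe_undominated m') (safe_undominated m) \<le> ereal (real m' / real m)"
  unfolding sup_value_ratio_def
proof (rule Sup_least, clarify)
  fix K H v assume "auction_instance K H v"
  then have v: "valuation v" by (simp add: auction_instance_def)
  define a where "a = max_value (safe_undominated m') K H v"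
  define b where "b = max_value (safe_undominated m) K H v"
  have ab: "0 \<le> a" "0 \<le> b" "real m * a \<le> real m' * b"
    unfolding a_def b_def using max_value_nonneg[OF v] max_value_ratio[OF v assms] assms by auto
  have "ereal a / ereal b \<le> ereal (real m' / real m)"
  \<comment> \<open>If \<open>b = 0\<close> the inequality forces \<open>a = 0\<close>, and the
    extended real quotient 0 / 0 is 0.\<close>
  proof (cases "b = 0")
    case True
    then have "a = 0" using ab assms(1) by (simp add: mult_le_0_iff)
    then show ?thesis using True by simp
  next
    case False
    then show ?thesis using ab assms by (simp add: field_simps)
  qed
  then show "value_ratio (safe_undominated m') (safe_undominated m) K H v \<le> ereal (real m' / real m)"
    by (simp add: value_ratio_def a_def b_def)
qed

section \<open>Tightness\<close>

text \<open>Under a constant valuation all averages agree and only one pair is possible. The single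
  larger first value makes the averages strictly decreasing, so every nonempty set of quantities in
  range is admissible.\<close>

definition hard_valuation :: "nat \<Rightarrow> real list" where
  "hard_valuation M = map (\<lambda>i. if i = 0 then 2 else 1) [0..<M]"

text \<open>The bids of 3 exceed every average value, so only \<open>q\<close> of the \<open>M\<close> units can be won.\<close>

definition hard_round :: "nat \<Rightarrow> nat \<Rightarrow> real list" where
  "hard_round M q = replicate (M - q) 3 @ replicate q (avg_val (hard_valuation M) q)"

lemma length_hard_valuation [simp]: "length (hard_valuation M) = M"
  by (simp add: hard_valuation_def)

lemma valuation_hard_valuation: "1 \<le> M \<Longrightarrow> valuation (hard_valuation M)"
  by (auto simp: valuation_def hard_valuation_def sorted_wrt_iff_nth_less)

lemma sum_hard_valuation:
  assumes "1 \<le> j" and "j \<le> M"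
  shows "(\<Sum>l<j. hard_valuation M ! l) = real j + 1"
  using assms
proof (induction j rule: dec_induct)
  case (step j)
  then show ?case by (simp add: hard_valuation_def)
qed (simp add: hard_valuation_def)

lemma avg_hard_valuation:
  assumes "1 \<le> j" and "j \<le> M"
  shows "avg_val (hard_valuation M) j = 1 + 1 / real j"
  using assms by (simp add: avg_val_def sum_hard_valuation field_simps)

lemma hard_avg_less_iff:
  assumes "1 \<le> r" and "r \<le> M" and "1 \<le> q" and "q \<le> M"
  shows "avg_val (hard_valuation M) r < avg_val (hard_valuation M) q \<longleftrightarrow> q < r"
  using assms by (simp add: avg_hard_valuation field_simps)

text \<open>There are \<open>M\<close> units. A bid \<open>w_r\<close> with \<open>r \<le> q\<close>
  is beaten only by the \<open>M - q\<close> bids of 3, since ties favor the bidder, and its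
  position is below \<open>q\<close>. With \<open>r > q\<close> all \<open>M\<close> competing bids
  are ahead of it.\<close>

lemma less_num_won_hard_round:
  assumes R: "R \<in> safe_qtys m (hard_valuation M)" and q: "1 \<le> q" "q \<le> M"
  shows "i < num_won M (safe_bids (hard_valuation M) R) (hard_round M q)
    \<longleftrightarrow> i < Max R \<and> next_qty R i \<le> q"
proof (cases "i < Max R")
  case True
  note n = next_qty[OF safe_qtysD(1,2)[OF R] True]
  have r: "1 \<le> next_qty R i" "next_qty R i \<le> M"
    using safe_qtysD(5,6)[OF R n(1)] by simp_all
  then have "avg_val (hard_valuation M) (next_qty R i) < 3"
    by (simp add: avg_hard_valuation field_simps)
  then have "length (filter (\<lambda>x. avg_val (hard_valuation M) (next_qty R i) < x) (hard_round M q))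
      = M - q + (if q < next_qty R i then q else 0)"
    using hard_avg_less_iff[OF r q] by (simp add: hard_round_def filter_replicate)
  then show ?thesis
    unfolding less_num_won_safe_bids[OF R] using True n(2) q by auto
qed (simp add: less_num_won_safe_bids[OF R])

text \<open>The shift by one makes the first \<open>A ^ l - 1\<close> units worth exactly
  \<open>A ^ l\<close>, as the prefix sums of the hard valuation are \<open>j + 1\<close>.\<close>

definition hard_qtys :: "nat \<Rightarrow> nat \<Rightarrow> nat set" where
  "hard_qtys A n = (\<lambda>l. A ^ l - 1) ` {1..n}"

definition hard_history :: "nat \<Rightarrow> nat \<Rightarrow> real list list" where
  "hard_history A n =
    concat (map (\<lambda>l. replicate (A ^ (n - l)) (hard_round (A ^ n - 1) (A ^ l - 1))) [1..<Suc n])"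

lemma total_value_hard_history:
  "total_value K v (hard_history A n) b =
    (\<Sum>l\<in>{1..n}. real (A ^ (n - l)) * won_value K v b (hard_round (A ^ n - 1) (A ^ l - 1)))"
proof -
  have concat: "sum_list (map f (concat xss)) = (\<Sum>xs\<leftarrow>xss. sum_list (map f xs))"
    for f :: "real list \<Rightarrow> real" and xss by (induction xss) auto
  have "total_value K v (hard_history A n) b = sum_list (map (won_value K v b) (hard_history A n))"
    by (simp add: total_value_def sum_list_sum_nth atLeast0LessThan)
  also have "\<dots> = (\<Sum>l\<leftarrow>[1..<Suc n].
      real (A ^ (n - l)) * won_value K v b (hard_round (A ^ n - 1) (A ^ l - 1)))"
    unfolding hard_history_def concat
    by (simp add: comp_def sum_list_replicate del: upt_Suc)
  also have "\<dots> = (\<Sum>l\<in>{1..n}.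
      real (A ^ (n - l)) * won_value K v b (hard_round (A ^ n - 1) (A ^ l - 1)))"
    by (simp only: interv_sum_list_conv_sum_set_nat atLeastLessThanSuc_atLeastAtMost set_upt)
  finally show ?thesis .
qed

section \<open>Values earned on the hard history\<close>

lemma power_minus_1_bounds:
  fixes A :: nat
  assumes "2 \<le> A" and "1 \<le> l" and "l \<le> n"
  shows "1 \<le> A ^ l - 1" and "A ^ l - 1 \<le> A ^ n - 1"
proof -
  have "A ^ 1 \<le> A ^ l" using assms by (intro power_increasing) auto
  then show "1 \<le> A ^ l - 1" using assms by simp
  show "A ^ l - 1 \<le> A ^ n - 1" using assms by (intro diff_le_mono power_increasing) auto
qed

lemma hard_qtys_safe:
  assumes A: "2 \<le> A" and n: "1 \<le> n"
  shows "hard_qtys A n \<in> safe_qtys n (hard_valuation (A ^ n - 1))"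
  unfolding safe_qtys_def hard_qtys_def
proof (intro CollectI conjI ballI impI)
  show "card ((\<lambda>l. A ^ l - 1) ` {1..n}) \<le> n"
    using card_image_le[of "{1..n}" "\<lambda>l. A ^ l - 1"] by simp
  show "(\<lambda>l. A ^ l - 1) ` {1..n} \<subseteq> {1..length (hard_valuation (A ^ n - 1))}"
    using power_minus_1_bounds[OF A] by auto
next
  fix r r' assume "r \<in> (\<lambda>l. A ^ l - 1) ` {1..n}" "r' \<in> (\<lambda>l. A ^ l - 1) ` {1..n}" "r < r'"
  then show "avg_val (hard_valuation (A ^ n - 1)) r' < avg_val (hard_valuation (A ^ n - 1)) r"
    using power_minus_1_bounds[OF A] by (subst hard_avg_less_iff) auto
qed (use n in auto)

lemma max_value_hard_ge:
  assumes A: "2 \<le> A" and n: "1 \<le> n"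
  shows "real n * real A ^ n
    \<le> max_value (safe_undominated n) (A ^ n - 1) (hard_history A n) (hard_valuation (A ^ n - 1))"
proof -
  define M where "M = A ^ n - 1"
  define R where "R = hard_qtys A n"
  let ?v = "hard_valuation M"
  have R: "R \<in> safe_qtys n ?v" unfolding R_def M_def by (rule hard_qtys_safe[OF assms])
  have "1 \<le> M" using power_minus_1_bounds[OF A n order_refl] by (simp add: M_def)
  then have v: "valuation ?v" by (rule valuation_hard_valuation)
  have "real A ^ n \<le> real (A ^ (n - l)) * won_value M ?v (safe_bids ?v R) (hard_round M (A ^ l - 1))"
    if l: "l \<in> {1..n}" for l
  proof -
    let ?q = "A ^ l - 1" and ?x = "num_won M (safe_bids ?v R) (hard_round M (A ^ l - 1))"
    have q: "1 \<le> ?q" "?q \<le> M" using power_minus_1_bounds[OF A, of l n] l by (auto simp: M_def)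
    have "?q \<in> R" using l by (auto simp: R_def hard_qtys_def)
    then have "?q \<le> Max R" using safe_qtysD(1)[OF R] by simp
    \<comment> \<open>Winning at the 0-based position \<open>?q - 1\<close> means winning at least
      \<open>?q\<close> units.\<close>
    then have "?q - 1 < Max R" using q by linarith
    moreover have "next_qty R (?q - 1) \<le> ?q"
      using next_qty(3)[OF safe_qtysD(1,2)[OF R] calculation \<open>?q \<in> R\<close>] q by simp
    ultimately have "?q - 1 < ?x"
      using less_num_won_hard_round[OF R q] by blast
    then have "?q \<le> ?x" by simp
    then have "(\<Sum>j<?q. ?v ! j) \<le> won_value M ?v (safe_bids ?v R) (hard_round M ?q)"
      unfolding won_value_def
      by (rule sum_valuation_mono[OF v]) (rule num_won_safe_bids_le[OF R])
    then have "real A ^ l \<le> won_value M ?v (safe_bids ?v R) (hard_round M ?q)"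
      using q by (simp add: sum_hard_valuation of_nat_diff)
    then have "real A ^ (n - l) * real A ^ l
        \<le> real A ^ (n - l) * won_value M ?v (safe_bids ?v R) (hard_round M ?q)"
      by (rule mult_left_mono) simp
    then show ?thesis using l by (simp flip: power_add)
  qed
  then have "(\<Sum>l\<in>{1..n}. real A ^ n) \<le> total_value M ?v (hard_history A n) (safe_bids ?v R)"
    unfolding total_value_hard_history M_def by (intro sum_mono) (simp add: M_def)
  also have "\<dots> \<le> max_value (safe_undominated n) M (hard_history A n) ?v"
    by (rule total_value_le_max_value[OF v R])
  finally show ?thesis by (simp add: M_def)
qed

text \<open>The windows are disjoint: the least exponent whose power of \<open>A\<close> exceeds
  \<open>r\<close> recovers the only window that can contain \<open>r\<close>. So \<open>R\<close>
  meets at most \<open>card R\<close> of them.\<close>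

lemma card_power_windows_le:
  fixes A :: nat
  assumes "2 \<le> A" and "finite R"
  shows "card {l \<in> {1..n}. \<exists>r\<in>R. A ^ (l - 1) \<le> r \<and> r < A ^ l} \<le> card R"
proof -
  define g where "g r = (LEAST l. r < A ^ l)" for r
  have g: "g r = l" if "1 \<le> l" "A ^ (l - 1) \<le> r" "r < A ^ l" for l r
    unfolding g_def
  proof (rule Least_equality)
    fix y assume "r < A ^ y"
    with that(2) have "A ^ (l - 1) < A ^ y" by (rule order_le_less_trans)
    then have "l - 1 < y" by (rule power_less_imp_less_exp[rotated]) (use assms(1) in simp)
    then show "l \<le> y" by simp
  qed (rule that(3))
  have "{l \<in> {1..n}. \<exists>r\<in>R. A ^ (l - 1) \<le> r \<and> r < A ^ l} \<subseteq> g ` R"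
  proof
    fix l assume "l \<in> {l \<in> {1..n}. \<exists>r\<in>R. A ^ (l - 1) \<le> r \<and> r < A ^ l}"
    then obtain r where l: "l \<in> {1..n}" and r: "r \<in> R" "A ^ (l - 1) \<le> r" "r < A ^ l" by blast
    from l have "1 \<le> l" by (simp only: atLeastAtMost_iff)
    then show "l \<in> g ` R" by (intro image_eqI[OF g[symmetric] r(1)] r)
  qed
  then show ?thesis by (rule surj_card_le[OF assms(2)])
qed

lemma max_value_hard_le:
  assumes A: "2 \<le> A" and n: "1 \<le> n" and m: "1 \<le> m"
  shows "max_value (safe_undominated m) (A ^ n - 1) (hard_history A n) (hard_valuation (A ^ n - 1))
    \<le> real m * real A ^ n + real n * real A ^ (n - 1)"
proof -
  define M where "M = A ^ n - 1"
  let ?v = "hard_valuation M"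
  have "1 \<le> M" using power_minus_1_bounds[OF A n order_refl] by (simp add: M_def)
  then have v: "valuation ?v" by (rule valuation_hard_valuation)
  obtain R where R: "R \<in> safe_qtys m ?v" and
    max: "max_value (safe_undominated m) M (hard_history A n) ?v
      = total_value M ?v (hard_history A n) (safe_bids ?v R)"
    using max_value_attained[OF v m] by metis
  define L where "L = {l \<in> {1..n}. \<exists>r\<in>R. A ^ (l - 1) \<le> r \<and> r < A ^ l}"
  have "card L \<le> m"
    using card_power_windows_le[OF A safe_qtysD(1)[OF R]] safe_qtysD(3)[OF R]
    unfolding L_def by (rule order_trans)
  have "real (A ^ (n - l)) * won_value M ?v (safe_bids ?v R) (hard_round M (A ^ l - 1))
      \<le> (if l \<in> L then real A ^ n else 0) + real A ^ (n - 1)" if l: "l \<in> {1..n}" for l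
  proof -
    let ?q = "A ^ l - 1" and ?x = "num_won M (safe_bids ?v R) (hard_round M (A ^ l - 1))"
    have q: "1 \<le> ?q" "?q \<le> M" using power_minus_1_bounds[OF A, of l n] l by (auto simp: M_def)
    \<comment> \<open>The won value is at most \<open>A ^ e\<close>: if \<open>R\<close> misses
      window \<open>l\<close>, the win shrinks by a factor of \<open>A\<close>.\<close>
    define e where "e = (if l \<in> L then l else l - 1)"
    have "won_value M ?v (safe_bids ?v R) (hard_round M ?q) \<le> real A ^ e"
    \<comment> \<open>The formula \<open>?x + 1\<close> for the won value fails when nothing is won,
      so that case is separate.\<close>
    proof (cases "?x = 0")
      case False
      define r where "r = next_qty R (?x - 1)"
      from False have x: "?x - 1 < Max R" "r \<le> ?q"
        using less_num_won_hard_round[OF R q, of "?x - 1"] by (auto simp: r_def)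
      have r: "r \<in> R" "?x \<le> r"
        using next_qty(1,2)[OF safe_qtysD(1,2)[OF R] x(1)] by (auto simp: r_def)
      have "r < A ^ l" using x(2) q(1) by linarith
      \<comment> \<open>For \<open>l\<close> outside \<open>L\<close>, an element of
        \<open>R\<close> below \<open>A ^ l\<close> cannot lie in window \<open>l\<close> and hence
        is below \<open>A ^ (l - 1)\<close>.\<close>
      then have "r < A ^ e" using r(1) l by (auto simp: e_def L_def not_le)
      then have "?x + 1 \<le> A ^ e" using r(2) by simp
      then have "real ?x + 1 \<le> real A ^ e" by (simp flip: of_nat_power)
      then show ?thesis
        using False num_won_safe_bids_le[OF R] by (simp add: won_value_def sum_hard_valuation)
    qed (simp add: won_value_def)
    then have "real A ^ (n - l) * won_value M ?v (safe_bids ?v R) (hard_round M ?q)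
        \<le> real A ^ (n - l) * real A ^ e"
      by (rule mult_left_mono) simp
    also have "\<dots> = (if l \<in> L then real A ^ n else real A ^ (n - 1))"
      using l by (simp add: e_def flip: power_add)
    also have "\<dots> \<le> (if l \<in> L then real A ^ n else 0) + real A ^ (n - 1)" by simp
    finally show ?thesis by simp
  qed
  then have "total_value M ?v (hard_history A n) (safe_bids ?v R)
      \<le> (\<Sum>l\<in>{1..n}. (if l \<in> L then real A ^ n else 0) + real A ^ (n - 1))"
    unfolding total_value_hard_history M_def by (intro sum_mono) (simp add: M_def)
  also have "\<dots> = real (card ({1..n} \<inter> L)) * real A ^ n + real n * real A ^ (n - 1)"
    by (simp add: sum.distrib flip: sum.inter_restrict)
  also have "{1..n} \<inter> L = L" by (auto simp: L_def)
  also have "real (card L) * real A ^ n + real n * real A ^ (n - 1)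
      \<le> real m * real A ^ n + real n * real A ^ (n - 1)"
    using \<open>card L \<le> m\<close> by (intro add_right_mono mult_right_mono) auto
  finally show ?thesis using max by (simp add: M_def)
qed

lemma hard_auction_instance:
  assumes A: "2 \<le> A" and n: "1 \<le> n"
  shows "auction_instance (A ^ n - 1) (hard_history A n) (hard_valuation (A ^ n - 1))"
proof -
  let ?M = "A ^ n - 1"
  have M: "1 \<le> ?M" using power_minus_1_bounds[OF A n order_refl] by simp
  have "0 \<le> x" if "l \<in> {1..n}" "x \<in> set (hard_round ?M (A ^ l - 1))" for l x
  proof -
    have "0 < avg_val (hard_valuation ?M) (A ^ l - 1)"
      using that(1) power_minus_1_bounds[OF A, of l n]
      by (intro avg_val_pos valuation_hard_valuation M) auto
    then show ?thesis using that(2) by (auto simp: hard_round_def split: if_splits)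
  qed
  moreover have "set (hard_history A n) = (\<lambda>l. hard_round ?M (A ^ l - 1)) ` {1..n}"
    unfolding hard_history_def set_concat set_map set_upt
    using A by (simp add: atLeastLessThanSuc_atLeastAtMost UNION_singleton_eq_range)
  moreover from this have "hard_history A n \<noteq> []" using n by auto
  ultimately show ?thesis
    unfolding auction_instance_def bid_history_def
    using M valuation_hard_valuation[OF M] by auto
qed

section \<open>Choice of the growth rate and the limit ratio\<close>

lemma value_ratio_hard_ge:
  fixes \<delta> :: real
  assumes m: "1 \<le> m" "m \<le> n" and \<delta>: "0 < \<delta>" "\<delta> \<le> 1 / 2"
  shows "\<exists>K H v. auction_instance K H v \<and>
    value_ratio (safe_undominated n) (safe_undominated m) K H v \<ge> ereal (real n / real m - \<delta>)"
proof -
  \<comment> \<open>The error term below is at most \<open>n ^ 2\<close>, against a gain of at least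
    \<open>\<delta> * A\<close>; the summand 2 secures \<open>2 \<le> A\<close>.\<close>
  obtain A :: nat where "real n ^ 2 / \<delta> + 2 < real A" using reals_Archimedean2 by blast
  moreover have "0 \<le> real n ^ 2 / \<delta>" using \<delta> by simp
  ultimately have A: "2 \<le> A" "real n ^ 2 / \<delta> \<le> real A" by linarith+
  have A\<delta>: "real n ^ 2 \<le> \<delta> * real A" using A(2) \<delta> by (simp add: field_simps)
  have n: "1 \<le> n" using m by simp
  define K where "K = A ^ n - 1"
  define H where "H = hard_history A n"
  define v where "v = hard_valuation K"
  have inst: "auction_instance K H v"
    unfolding K_def H_def v_def by (rule hard_auction_instance[OF A(1) n])
  then have v: "valuation v" by (simp add: auction_instance_def)
  define a where "a = max_value (safe_undominated n) K H v"
  define b where "b = max_value (safe_undominated m) K H v"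
  have a: "real n * real A ^ n \<le> a"
    unfolding a_def K_def H_def v_def by (rule max_value_hard_ge[OF A(1) n])
  have b: "b \<le> real m * real A ^ n + real n * real A ^ (n - 1)"
    unfolding b_def K_def H_def v_def by (rule max_value_hard_le[OF A(1) n m(1)])
  \<comment> \<open>Positivity of \<open>b\<close> follows from that of \<open>a\<close> through the
    upper bound on the ratio, without evaluating any strategy with \<open>m\<close> pairs.\<close>
  have "0 < real n * real A ^ n" using n A(1) by simp
  then have "0 < real m * a" using a m(1) by simp
  also have "\<dots> \<le> real n * b"
    unfolding a_def b_def by (rule max_value_ratio[OF v m])
  finally have "0 < b" using n by (simp add: zero_less_mult_iff)
  \<comment> \<open>Since \<open>\<delta> \<le> 1 / 2\<close>, the factor is nonnegative and the
    bound on \<open>b\<close> may be multiplied by it.\<close>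
  have "1 \<le> real n / real m" using m by simp
  then have "0 \<le> real n / real m - \<delta>" using \<delta> by linarith
  then have "(real n / real m - \<delta>) * b
      \<le> (real n / real m - \<delta>) * (real m * real A ^ n + real n * real A ^ (n - 1))"
    using b by (rule mult_left_mono[rotated])
  also have "\<dots> = real A ^ (n - 1) * ((real n / real m - \<delta>) * (real m * real A + real n))"
    using n by (simp add: power_eq_if algebra_simps)
  also have "(real n / real m - \<delta>) * (real m * real A + real n) \<le> real n * real A"
  proof -
    have "(real n / real m - \<delta>) * (real m * real A + real n)
        = real n * real A + real n ^ 2 / real m - \<delta> * real A * real m - \<delta> * real n"
      using m(1) by (simp add: field_simps power2_eq_square)
    moreover have "real n ^ 2 / real m \<le> real n ^ 2"
      using m(1) by (simp add: divide_le_eq mult_le_cancel_left1)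
    moreover have "\<delta> * real A * 1 \<le> \<delta> * real A * real m"
      using m(1) \<delta> by (intro mult_left_mono) auto
    moreover have "0 \<le> \<delta> * real n" using \<delta> by simp
    ultimately show ?thesis using A\<delta> by linarith
  qed
  then have "real A ^ (n - 1) * ((real n / real m - \<delta>) * (real m * real A + real n))
      \<le> real A ^ (n - 1) * (real n * real A)"
    by (rule mult_left_mono) simp
  also have "\<dots> = real n * real A ^ n" using n by (simp add: power_eq_if)
  also note a
  finally have "real n / real m - \<delta> \<le> a / b" using \<open>0 < b\<close> by (simp add: le_divide_eq)
  then have "value_ratio (safe_undominated n) (safe_undominated m) K H v \<ge> ereal (real n / real m - \<delta>)"
    using \<open>0 < b\<close> by (simp add: value_ratio_def flip: a_def b_def)
  then show ?thesis using inst by blast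
qed

theorem mainTheorem9:
  fixes m m' :: nat
  assumes "1 \<le> m" and "m \<le> m'"
  shows "sup_value_ratio (safe_undominated m') (safe_undominated m) \<le> ereal (real m' / real m)
    \<and> (\<forall>\<delta>::real. 0 < \<delta> \<and> \<delta> \<le> 1 / 2 \<longrightarrow>
         (\<exists>K H v. auction_instance K H v \<and>
            value_ratio (safe_undominated m') (safe_undominated m) K H v
              \<ge> ereal (real m' / real m - \<delta>)))
    \<and> has_richness_ratio (safe_undominated m') m (real m / real m')"
proof -
  have upper: "sup_value_ratio (safe_undominated m') (safe_undominated m) \<le> ereal (real m' / real m)"
    by (rule sup_value_ratio_le[OF assms])
  have lower: "\<exists>K H v. auction_instance K H v \<and>
      value_ratio (safe_undominated m') (safe_undominated m) K H v \<ge> ereal (real m' / real m - \<delta>)"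
    if "0 < \<delta>" "\<delta> \<le> 1 / 2" for \<delta> :: real
    by (rule value_ratio_hard_ge[OF assms that])
  \<comment> \<open>The witnesses are \<open>lam = m' / m\<close> and the threshold 1/2, up to which
    the lower bound is available.\<close>
  have "has_richness_ratio (safe_undominated m') m (real m / real m')"
    unfolding has_richness_ratio_def
    using assms upper lower
    by (intro exI[of _ "real m' / real m"] conjI exI[of _ "1 / 2 :: real"]) auto
  then show ?thesis using upper lower by blast
qed

end
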